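(* Let $\varphi(x_1,x_2,\dots)$ be an arbitrary symmetric function (an element of the algebra $\Lambda$ of symmetric functions over $\mathbb R$) and define the function $G_\varphi$ on the set $\mathbb Y$ of all Young diagrams by $$G_\varphi(\lambda)=\varphi(c_1(\lambda),\dots,c_{|\lambda|}(\lambda),0,0,\dots),\qquad \lambda\in\mathbb Y.$$ Then the Plancherel average $\langle G_\varphi\rangle_n$ is a polynomial function of $n$ (i.e. there is a polynomial $P\in\mathbb R[t]$ with $\langle G_\varphi\rangle_n=P(n)$ for all $n\ge1$).
   Context: $\mathbb Y$ is the set of all Young diagrams (integer partitions); $\mathbb Y_n$ is the set of diagrams with $n$ boxes. For $\lambda\in\mathbb Y$, $|\lambda|$ is its number of boxes and $\dim\lambda$ is the number of standard Young tableaux of shape $\lambda$. The content of the box in row $i$ and column $j$ is $j-i$; $c_1(\lambda),\dots,c_{|\lambda|}(\lambda)$ are the contents of the boxes of $\lambda$ in any order. The Plancherel measure on $\mathbb Y_n$ is $M_n(\lambda)=(\dim\lambda)^2/n!$, and for a function $F$ on $\mathbb Y$, its $n$th Plancherel average is $\langle F\rangle_n=\sum_{\lambda\in\mathbb Y_n}\frac{(\dim\lambda)^2}{n!}F(\lambda)$. *)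

theory Defs
  imports Complex_Main "HOL-Computational_Algebra.Polynomial"
begin

definition is_partition :: "nat list \<Rightarrow> bool" where
  "is_partition la \<longleftrightarrow> sorted (rev la) \<and> 0 \<notin> set la"

definition YD :: "nat \<Rightarrow> nat list set" where
  "YD n = {la. is_partition la \<and> sum_list la = n}"

definition boxes :: "nat list \<Rightarrow> (nat \<times> nat) set" where
  "boxes la = {(i, j). i < length la \<and> j < la ! i}"

definition content :: "nat \<times> nat \<Rightarrow> int" where
  "content b = int (snd b) - int (fst b)"

definition contents :: "nat list \<Rightarrow> real list" where
  "contents la = concat (map (\<lambda>i. map (\<lambda>j. real_of_int (content (i, j))) [0..<la ! i]) [0..<length la])"

definition SYT :: "nat list \<Rightarrow> (nat \<times> nat \<Rightarrow> nat) set" where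
  "SYT la = {T. bij_betw T (boxes la) {1..sum_list la}
               \<and> (\<forall>b. b \<notin> boxes la \<longrightarrow> T b = 0)
               \<and> (\<forall>i j. (i, Suc j) \<in> boxes la \<longrightarrow> T (i, j) < T (i, Suc j))
               \<and> (\<forall>i j. (Suc i, j) \<in> boxes la \<longrightarrow> T (i, j) < T (Suc i, j))}"

definition dimYD :: "nat list \<Rightarrow> nat" where
  "dimYD la = card (SYT la)"

definition plancherel_avg :: "(nat list \<Rightarrow> real) \<Rightarrow> nat \<Rightarrow> real" where
  "plancherel_avg F n = (\<Sum>la\<in>YD n. real (dimYD la) ^ 2 / fact n * F la)"

text \<open>Monomial symmetric function m_mu evaluated at (x_1,...,x_N,0,0,...):
  sum of x^alpha over distinct exponent vectors alpha that are rearrangements of mu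
  (padded with zeros).\<close>
definition mono_sym :: "nat list \<Rightarrow> real list \<Rightarrow> real" where
  "mono_sym mu xs =
     (\<Sum>al\<in>{al. length al = length xs \<and> mset (filter (\<lambda>k. k \<noteq> 0) al) = mset mu}.
        \<Prod>i<length xs. (xs ! i) ^ (al ! i))"

text \<open>A symmetric function over R is a finite real linear combination of monomial
  symmetric functions m_mu (mu a partition); it is encoded by its coefficient function.\<close>
definition is_symfun :: "(nat list \<Rightarrow> real) \<Rightarrow> bool" where
  "is_symfun c \<longleftrightarrow> finite {mu. c mu \<noteq> 0} \<and> (\<forall>mu. c mu \<noteq> 0 \<longrightarrow> is_partition mu)"

definition symfun_eval :: "(nat list \<Rightarrow> real) \<Rightarrow> real list \<Rightarrow> real" where
  "symfun_eval c xs = (\<Sum>mu\<in>{mu. c mu \<noteq> 0}. c mu * mono_sym mu xs)"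

definition G :: "(nat list \<Rightarrow> real) \<Rightarrow> nat list \<Rightarrow> real" where
  "G c la = symfun_eval c (contents la)"

end

theory Submission
  imports Defs "HOL-Library.Multiset" "HOL-Combinatorics.Permutations"
begin

text \<open>
  Let \<open>D\<close> remove a box in all possible ways and let \<open>U\<^sub>k\<close> add a box in all possible ways, weighted by
  the \<open>k\<close>-th power of its content. Since \<open>D\<^sup>n \<lambda>\<close> counts standard tableaux, and a symmetric function of
  contents may be evaluated along any standard tableau, the average of the monomial symmetric
  function of \<open>\<mu>\<close> is the sum of \<open>W(w) = \<langle>D\<^sup>n U\<^bsub>w\<^esub> \<emptyset>\<rangle> / n!\<close> over all words \<open>w\<close> of length \<open>n\<close> whose
  nonzero letters are the parts of \<open>\<mu>\<close>. The commutator of \<open>D\<close> and \<open>U\<^sub>k\<close> is the diagonal operator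
  (sum of \<open>c\<^sup>k\<close> over addable boxes) - (sum of \<open>c\<^sup>k\<close> over removable boxes), which is
  \<open>0\<^sup>k\<close> plus a combination of the power sums \<open>p\<^sub>m\<close> of the contents with \<open>m \<le> k - 2\<close>; moreover
  \<open>p\<^sub>m U\<^sub>k = U\<^sub>k p\<^sub>m + U\<^bsub>k+m\<^esub>\<close>. This yields a recursion for \<open>W\<close> that only involves words.
  Moebius inversion over the deletion of zero letters gives \<open>W(w) = \<Sum> V(v)\<close> over the subwords \<open>v\<close> of
  \<open>w\<close> containing all nonzero letters. The recursion for \<open>V\<close> lowers the length by at most 2
  and the sum of the letters by at least 2, so \<open>V(v) = 0\<close> when \<open>v\<close> is longer than its sum of letters.
  Hence the average is a finite combination of binomial coefficients \<open>n choose r\<close>.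
\<close>

subsection \<open>Functions on words\<close>

primrec raise :: "nat \<Rightarrow> (nat list \<Rightarrow> real) \<Rightarrow> nat list \<Rightarrow> real" where
  "raise m V [] = 0"
| "raise m V (k # w) = V ((k + m) # w) + raise m (\<lambda>u. V (k # u)) w"

primrec drop_zero :: "(nat list \<Rightarrow> real) \<Rightarrow> nat list \<Rightarrow> real" where
  "drop_zero V [] = 0"
| "drop_zero V (k # w) = (if k = 0 then V w else 0) + drop_zero (\<lambda>u. V (k # u)) w"

text \<open>For \<open>m \<le> k\<close>, the coefficient of x^m in (x + 1)^k + (x - 1)^k. It is 0
  at m = k - 1 and 2 at m = k, so subtracting 2 x^k leaves exactly the range
  \<open>m < k - 1\<close> used in the sums below.\<close>

definition diff_coeff :: "nat \<Rightarrow> nat \<Rightarrow> real" where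
  "diff_coeff k m = real (k choose m) * (1 + (-1) ^ (k - m))"

text \<open>
  The first letter of a word is the exponent of the box added last. Operators on formal sums of
  words are encoded by their transposes, acting on functions \<open>V\<close> of words: \<open>raise m\<close> is
  multiplication by \<open>p\<^sub>m\<close> and \<open>lower\<close> is \<open>D\<close>. The variant \<open>lower_red\<close> is what \<open>lower\<close> becomes after
  Moebius inversion over the deletion of zero letters.
\<close>

primrec lower :: "(nat list \<Rightarrow> real) \<Rightarrow> nat list \<Rightarrow> real" where
  "lower V [] = 0"
| "lower V (k # w) = (if k = 0 then V w else 0)
     + (\<Sum>m<k - 1. diff_coeff k m * raise m V w) + lower (\<lambda>u. V (k # u)) w"

primrec lower_red :: "(nat list \<Rightarrow> real) \<Rightarrow> nat list \<Rightarrow> real" where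
  "lower_red V [] = 0"
| "lower_red V (k # w) =
     (\<Sum>m<k - 1. diff_coeff k m * (raise m V w + (if m = 0 then drop_zero V w else 0)))
     + lower_red (\<lambda>u. V (k # u)) w"

text \<open>Every set of positions carrying a zero is deleted once, so equal subwords are counted
  with multiplicity.\<close>

primrec subword_sum :: "(nat list \<Rightarrow> real) \<Rightarrow> nat list \<Rightarrow> real" where
  "subword_sum V [] = V []"
| "subword_sum V (k # w) = subword_sum (\<lambda>u. V (k # u)) w + (if k = 0 then subword_sum V w else 0)"

text \<open>The Moebius inverse of \<open>subword_sum\<close>: each deleted zero contributes a
  factor -1.\<close>

primrec subword_inv :: "(nat list \<Rightarrow> real) \<Rightarrow> nat list \<Rightarrow> real" where
  "subword_inv V [] = V []"
| "subword_inv V (k # w) = subword_inv (\<lambda>u. V (k # u)) w - (if k = 0 then subword_inv V w else 0)"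

section \<open>Linearity of the operators on word functions\<close>

lemma raise_sum: "raise m (\<lambda>u. \<Sum>i\<in>I. a i * F i u) w = (\<Sum>i\<in>I. a i * raise m (F i) w)"
  by (induction w arbitrary: F) (simp_all add: sum.distrib distrib_left)

lemma lower_sum: "lower (\<lambda>u. \<Sum>i\<in>I. a i * F i u) w = (\<Sum>i\<in>I. a i * lower (F i) w)"
proof (induction w arbitrary: F)
  case (Cons k w)
  have "(\<Sum>m<k - 1. diff_coeff k m * (\<Sum>i\<in>I. a i * raise m (F i) w))
      = (\<Sum>i\<in>I. a i * (\<Sum>m<k - 1. diff_coeff k m * raise m (F i) w))"
    unfolding sum_distrib_left by (subst sum.swap) (simp add: mult.left_commute)
  then show ?case
    by (simp add: Cons.IH raise_sum sum.distrib distrib_left)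
qed simp

lemma raise_add: "raise m (\<lambda>u. F u + H u) w = raise m F w + raise m H w"
  by (induction w arbitrary: F H) simp_all

lemma lower_add: "lower (\<lambda>u. F u + H u) w = lower F w + lower H w"
  by (induction w arbitrary: F H) (simp_all add: raise_add distrib_left sum.distrib)

lemma subword_sum_add: "subword_sum (\<lambda>u. F u + H u) w = subword_sum F w + subword_sum H w"
  by (induction w arbitrary: F H) simp_all

lemma subword_sum_diff: "subword_sum (\<lambda>u. F u - H u) w = subword_sum F w - subword_sum H w"
  by (induction w arbitrary: F H) simp_all

lemma subword_sum_cmult: "subword_sum (\<lambda>u. a * F u) w = a * subword_sum F w"
  by (induction w arbitrary: F) (simp_all add: algebra_simps)

lemma subword_inv_add: "subword_inv (\<lambda>u. F u + H u) w = subword_inv F w + subword_inv H w"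
  by (induction w arbitrary: F H) simp_all

lemma subword_inv_zero: "subword_inv (\<lambda>u. 0) w = 0"
  by (induction w) simp_all

lemma subword_sum_sum: "subword_sum (\<lambda>u. \<Sum>i\<in>I. F i u) w = (\<Sum>i\<in>I. subword_sum (F i) w)"
  by (induction w arbitrary: F) (simp_all add: sum.distrib)

section \<open>Moebius inversion over deleted zeros\<close>

lemma subword_sum_inv: "subword_sum (subword_inv V) w = V w"
proof (induction w arbitrary: V)
  case (Cons k w)
  then show ?case by (cases "k = 0") (simp_all add: subword_sum_diff)
qed simp

lemma subword_inv_sum: "subword_inv (subword_sum V) w = V w"
proof (induction w arbitrary: V)
  case (Cons k w)
  then show ?case by (cases "k = 0") (simp_all add: subword_inv_add)
qed simp

lemma raise_0: "raise 0 V w = real (length w) * V w"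
  by (induction w arbitrary: V) (simp_all add: algebra_simps)

text \<open>For \<open>m > 0\<close> a raised letter is nonzero and cannot be deleted afterwards, so
  in either order one raises a letter that survives the deletion.\<close>

lemma raise_subword_sum: "m > 0 \<Longrightarrow> raise m (subword_sum V) w = subword_sum (raise m V) w"
proof (induction w arbitrary: V)
  case (Cons k w)
  then show ?case
    by (cases "k = 0") (simp_all add: subword_sum_add raise_add)
qed simp

lemma subword_sum_shift:
  "subword_sum (\<lambda>u. (a - (1 + real (length u))) * F u) w + subword_sum F w
   = subword_sum (\<lambda>u. (a - real (length u)) * F u) w"
  unfolding subword_sum_add[symmetric] by (simp add: algebra_simps)

text \<open>Any of the deleted positions may be the one that \<open>drop_zero\<close> removed last;
  their number is the difference of the lengths.\<close>

lemma subword_sum_drop_zero: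
  "subword_sum (drop_zero V) w = subword_sum (\<lambda>u. (real (length w) - real (length u)) * V u) w"
proof (induction w arbitrary: V)
  case (Cons k w)
  have *: "(real (Suc (length w)) - real (length u)) * V u
    = (real (length w) - real (length u)) * V u + V u" for u
    by (simp add: algebra_simps)
  show ?case
  proof (cases "k = 0")
    case True
    then show ?thesis
      unfolding subword_sum.simps length_Cons *
      by (simp add: Cons.IH subword_sum_add subword_sum_shift)
  next
    case False
    then show ?thesis by (simp add: Cons.IH subword_sum_add)
  qed
qed simp

text \<open>\<open>raise 0\<close> counts all letters of \<open>w\<close>: the surviving ones give
  \<open>raise 0 V\<close>, the deleted ones give \<open>drop_zero V\<close>. This is the source of
  the extra term in \<open>lower_red\<close>.\<close>

lemma raise_0_subword_sum:
  "raise 0 (subword_sum V) w = subword_sum (\<lambda>u. raise 0 V u + drop_zero V u) w"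
proof -
  have "subword_sum (\<lambda>u. raise 0 V u + drop_zero V u) w
    = subword_sum (\<lambda>u. real (length u) * V u) w
      + subword_sum (\<lambda>u. (real (length w) - real (length u)) * V u) w"
    by (simp add: subword_sum_add subword_sum_drop_zero raise_0)
  also have "\<dots> = subword_sum (\<lambda>u. real (length w) * V u) w"
    unfolding subword_sum_add[symmetric] by (simp add: algebra_simps)
  also have "\<dots> = raise 0 (subword_sum V) w"
    by (simp add: subword_sum_cmult raise_0)
  finally show ?thesis by simp
qed

text \<open>The summand of \<open>lower\<close> for \<open>k = 0\<close> deletes one zero before
  \<open>subword_sum\<close> deletes the others. This marks one deleted position, hence the weight
  \<open>length w - length u\<close>; all other summands pass through \<open>subword_sum\<close> by
  the two preceding rules for \<open>raise\<close>.\<close>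

lemma lower_subword_sum:
  "lower (subword_sum V) w
   = subword_sum (lower_red V) w + subword_sum (\<lambda>u. (real (length w) - real (length u)) * V u) w"
proof (induction w arbitrary: V)
  case (Cons k w)
  have *: "(real (Suc (length w)) - real (length u)) * V u
    = (real (length w) - real (length u)) * V u + V u" for u
    by (simp add: algebra_simps)
  have raise: "raise m (subword_sum V) w =
      subword_sum (\<lambda>u. raise m V u + (if m = 0 then drop_zero V u else 0)) w" for m
    by (cases "m = 0") (simp_all add: raise_0_subword_sum raise_subword_sum)
  show ?case
  proof (cases "k = 0")
    case True
    then show ?thesis
      unfolding subword_sum.simps length_Cons *
      by (simp add: Cons.IH lower_add subword_sum_add subword_sum_shift)
  next
    case False
    then show ?thesis
      by (simp add: Cons.IH subword_sum_add subword_sum_sum subword_sum_cmult raise)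
  qed
qed simp

section \<open>Lengths and letter sums of the words involved\<close>

lemma raise_cong:
  "(\<And>u. length u = length w \<Longrightarrow> V u = V' u) \<Longrightarrow> raise m V w = raise m V' w"
proof (induction w arbitrary: V V')
  case (Cons k w)
  have "raise m (\<lambda>u. V (k # u)) w = raise m (\<lambda>u. V' (k # u)) w"
    by (rule Cons.IH) (simp add: Cons.prems)
  then show ?case by (simp add: Cons.prems)
qed simp

lemma lower_cong:
  "(\<And>u. Suc (length u) = length w \<Longrightarrow> V u = V' u) \<Longrightarrow> lower V w = lower V' w"
proof (induction w arbitrary: V V')
  case (Cons k w)
  have "lower (\<lambda>u. V (k # u)) w = lower (\<lambda>u. V' (k # u)) w"
    by (rule Cons.IH) (simp add: Cons.prems)
  moreover have "raise m V w = raise m V' w" for m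
    by (rule raise_cong) (simp add: Cons.prems)
  ultimately show ?case by (simp add: Cons.prems)
qed simp

lemma raise_eq_0:
  "(\<And>u. length u = length w \<Longrightarrow> sum_list u = sum_list w + m \<Longrightarrow> V u = 0) \<Longrightarrow> raise m V w = 0"
proof (induction w arbitrary: V)
  case (Cons k w)
  have "raise m (\<lambda>u. V (k # u)) w = 0"
    by (rule Cons.IH) (simp add: Cons.prems)
  then show ?case by (simp add: Cons.prems)
qed simp

lemma drop_zero_eq_0:
  "(\<And>u. Suc (length u) = length w \<Longrightarrow> sum_list u = sum_list w \<Longrightarrow> V u = 0) \<Longrightarrow> drop_zero V w = 0"
proof (induction w arbitrary: V)
  case (Cons k w)
  have "drop_zero (\<lambda>u. V (k # u)) w = 0"
    by (rule Cons.IH) (simp add: Cons.prems)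
  then show ?case by (simp add: Cons.prems)
qed simp

text \<open>Only a letter \<open>k \<ge> 2\<close> is ever removed, and at most k - 2 is added back
  to another letter. A second letter, a zero, disappears only in the \<open>drop_zero\<close>
  term.\<close>

lemma lower_red_eq_0:
  "(\<And>u. length u < length w \<Longrightarrow> length w \<le> length u + 2 \<Longrightarrow> sum_list u + 2 \<le> sum_list w \<Longrightarrow> V u = 0)
   \<Longrightarrow> lower_red V w = 0"
proof (induction w arbitrary: V)
  case (Cons k w)
  have "lower_red (\<lambda>u. V (k # u)) w = 0"
    by (rule Cons.IH) (simp add: Cons.prems)
  moreover have "raise m V w + (if m = 0 then drop_zero V w else 0) = 0" if "m < k - 1" for m
  proof -
    have "raise m V w = 0"
      by (rule raise_eq_0) (use that Cons.prems in simp)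
    moreover have "drop_zero V w = 0"
      by (rule drop_zero_eq_0) (use that Cons.prems in simp)
    ultimately show ?thesis by simp
  qed
  ultimately show ?case by (simp add: sum.neutral)
qed simp

text \<open>In \<open>lower_subword_sum\<close> the term with \<open>length w\<close> reproduces the
  left side of the assumption and cancels; applying \<open>subword_inv\<close> to what remains
  removes the sum over subwords.\<close>

lemma lower_red_inv:
  assumes "\<And>w. real (length w) * W w = lower W w"
  shows "lower_red (subword_inv W) w = real (length w) * subword_inv W w"
proof -
  let ?V = "subword_inv W"
  have W: "subword_sum ?V = W" by (rule ext) (rule subword_sum_inv)
  have "subword_sum (\<lambda>u. lower_red ?V u - real (length u) * ?V u) = (\<lambda>w. 0)"
  proof
    fix w
    have "real (length w) * W w = subword_sum (lower_red ?V) w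
        + subword_sum (\<lambda>u. (real (length w) - real (length u)) * ?V u) w"
      unfolding assms using lower_subword_sum[of ?V w] by (simp add: W)
    also have "subword_sum (\<lambda>u. (real (length w) - real (length u)) * ?V u) w
        = real (length w) * W w - subword_sum (\<lambda>u. real (length u) * ?V u) w"
      by (simp add: left_diff_distrib subword_sum_diff subword_sum_cmult W)
    finally show "subword_sum (\<lambda>u. lower_red ?V u - real (length u) * ?V u) w = 0"
      by (simp add: subword_sum_diff)
  qed
  then have "lower_red ?V w - real (length w) * ?V w = subword_inv (\<lambda>w. 0) w"
    using subword_inv_sum[of "\<lambda>u. lower_red ?V u - real (length u) * ?V u" w] by simp
  then show ?thesis by (simp add: subword_inv_zero)
qed

text \<open>The words \<open>u\<close> occurring in the recursion satisfy sum u \<le> sum w - 2 <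
  |w| - 2 \<le> |u|, so the condition is inherited. Since |w| > 0, the factor |w| can be divided
  out.\<close>

lemma subword_inv_eq_0:
  assumes W: "\<And>w. real (length w) * W w = lower W w"
    and "sum_list w < length w"
  shows "subword_inv W w = 0"
  using assms(2)
proof (induction "length w" arbitrary: w rule: less_induct)
  case less
  have "lower_red (subword_inv W) w = 0"
    by (rule lower_red_eq_0) (use less in auto)
  with less.prems show ?case
    by (auto simp: lower_red_inv[OF W])
qed

section \<open>Words with prescribed nonzero letters\<close>

definition words :: "nat \<Rightarrow> nat multiset \<Rightarrow> nat list set" where
  "words n M = {al. length al = n \<and> mset (filter (\<lambda>k. k \<noteq> 0) al) = M}"

lemma finite_words: "finite (words n M)"
proof (rule finite_subset)
  have "k = 0 \<or> k \<in># mset (filter (\<lambda>k. k \<noteq> 0) al)" if "k \<in> set al" for k al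
    using that by auto
  then show "words n M \<subseteq> {al. set al \<subseteq> insert 0 (set_mset M) \<and> length al = n}"
    unfolding words_def by blast
  show "finite {al. set al \<subseteq> insert 0 (set_mset M) \<and> length al = n}"
    by (rule finite_lists_length_eq) simp
qed

lemma words_0: "words 0 M = (if M = {#} then {[]} else {})"
  by (auto simp: words_def)

text \<open>As \<open>0\<close> is not in \<open>M\<close>, \<open>M - {#0#}\<close> equals
  \<open>M\<close>, which lets a leading zero be treated like a leading letter from
  \<open>M\<close>.\<close>

lemma words_Suc:
  assumes "0 \<notin># M"
  shows "words (Suc n) M = (\<Union>k\<in>insert 0 (set_mset M). Cons k ` words n (M - {#k#}))"
  using assms by (auto simp: words_def length_Suc_conv image_iff split: if_splits)

lemma sum_words_Suc:
  assumes "0 \<notin># M"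
  shows "sum F (words (Suc n) M)
    = (\<Sum>k\<in>insert 0 (set_mset M). \<Sum>w\<in>words n (M - {#k#}). F (k # w))"
proof -
  have "sum F (words (Suc n) M)
      = (\<Sum>k\<in>insert 0 (set_mset M). sum F (Cons k ` words n (M - {#k#})))"
    unfolding words_Suc[OF assms]
    by (rule sum.UNION_disjoint) (auto simp: finite_words)
  also have "\<dots> = (\<Sum>k\<in>insert 0 (set_mset M). \<Sum>w\<in>words n (M - {#k#}). F (k # w))"
    by (simp add: sum.reindex)
  finally show ?thesis .
qed

text \<open>Double counting: choose which r of the n positions survive, write a word of
  \<open>words r M\<close> there and zeros elsewhere. The induction is Pascal's rule.\<close>

lemma sum_words_subword_sum:
  assumes "0 \<notin># M"
  shows "(\<Sum>w\<in>words n M. subword_sum V w) = (\<Sum>r\<le>n. real (n choose r) * sum V (words r M))"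
  using assms
proof (induction n arbitrary: M V)
  case 0
  then show ?case by (simp add: words_0)
next
  case (Suc n)
  let ?I = "insert 0 (set_mset M)"
  have nz: "0 \<notin># M - {#k#}" for k
    using Suc.prems by (meson in_diffD)
  have M0: "M - {#0#} = M" using Suc.prems by simp
  have "(\<Sum>w\<in>words (Suc n) M. subword_sum V w)
      = (\<Sum>k\<in>?I. \<Sum>w\<in>words n (M - {#k#}). subword_sum (\<lambda>u. V (k # u)) w)
        + (\<Sum>k\<in>?I. \<Sum>w\<in>words n (M - {#k#}). if k = 0 then subword_sum V w else 0)"
    by (simp add: sum_words_Suc[OF Suc.prems] sum.distrib del: sum.insert)
  also have "(\<Sum>k\<in>?I. \<Sum>w\<in>words n (M - {#k#}). if k = 0 then subword_sum V w else 0)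
      = (\<Sum>w\<in>words n M. subword_sum V w)"
    by (subst sum.remove[of _ 0]) (use M0 in \<open>auto intro!: sum.neutral\<close>)
  also have "\<dots> = (\<Sum>r\<le>n. real (n choose r) * sum V (words r M))"
    by (rule Suc.IH) (rule Suc.prems)
  also have "(\<Sum>k\<in>?I. \<Sum>w\<in>words n (M - {#k#}). subword_sum (\<lambda>u. V (k # u)) w)
      = (\<Sum>r\<le>n. real (n choose r) * sum V (words (Suc r) M))"
    unfolding Suc.IH[OF nz] sum_words_Suc[OF Suc.prems]
    by (subst sum.swap) (simp add: sum_distrib_left del: sum.insert)
  also have "(\<Sum>r\<le>n. real (n choose r) * sum V (words (Suc r) M))
        + (\<Sum>r\<le>n. real (n choose r) * sum V (words r M))
      = (\<Sum>r\<le>Suc n. real (Suc n choose r) * sum V (words r M))"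
  proof -
    \<comment> \<open>The new top term vanishes because \<open>n choose Suc n\<close> is 0;
      splitting off r = 0 then aligns both sums for Pascal's rule.\<close>
    have "(\<Sum>r\<le>n. real (n choose r) * sum V (words r M))
      = (\<Sum>r\<le>Suc n. real (n choose r) * sum V (words r M))" by simp
    also have "\<dots> = sum V (words 0 M) + (\<Sum>r\<le>n. real (n choose Suc r) * sum V (words (Suc r) M))"
      by (simp only: sum.atMost_Suc_shift) simp
    finally show ?thesis
      by (simp only: sum.atMost_Suc_shift) (simp add: algebra_simps sum.distrib)
  qed
  finally show ?case .
qed

lemma binomial_poly: "\<exists>P :: real poly. \<forall>n. real (n choose r) = poly P (real n)"
proof (intro exI allI)
  fix n
  show "real (n choose r) = poly (smult (1 / fact r) (\<Prod>i = 0..<r. [:- real i, 1:])) (real n)"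
    by (simp add: binomial_gbinomial gbinomial_prod_rev poly_prod)
qed

lemma sum_poly:
  fixes F :: "'a \<Rightarrow> nat \<Rightarrow> real"
  assumes "\<And>i. i \<in> I \<Longrightarrow> \<exists>P :: real poly. \<forall>n. F i n = poly P (real n)"
  shows "\<exists>P :: real poly. \<forall>n. (\<Sum>i\<in>I. a i * F i n) = poly P (real n)"
proof -
  from assms obtain P :: "'a \<Rightarrow> real poly" where "\<And>i n. i \<in> I \<Longrightarrow> F i n = poly (P i) (real n)"
    by metis
  then have "\<forall>n. (\<Sum>i\<in>I. a i * F i n) = poly (\<Sum>i\<in>I. smult (a i) (P i)) (real n)"
    by (simp add: poly_sum)
  then show ?thesis by blast
qed

text \<open>After inversion \<open>n\<close> enters only through \<open>n choose r\<close>, and the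
  vanishing of \<open>subword_inv W\<close> on long words bounds r by the sum of \<open>M\<close>,
  independently of \<open>n\<close>.\<close>

lemma sum_words_poly:
  assumes M: "0 \<notin># M" and W: "\<And>w. real (length w) * W w = lower W w"
  shows "\<exists>P :: real poly. \<forall>n. sum W (words n M) = poly P (real n)"
proof -
  let ?V = "subword_inv W"
  let ?B = "\<lambda>r. sum ?V (words r M)"
  let ?K = "sum_mset M"
  have sum_list: "sum_list (filter (\<lambda>k. k \<noteq> 0) w) = sum_list w" for w :: "nat list"
    by (induction w) auto
  have B: "?B r = 0" if "r > ?K" for r
  proof (rule sum.neutral, rule ballI)
    fix w assume "w \<in> words r M"
    then have "length w = r" "sum_list w = ?K"
      using sum_list[of w] by (auto simp: words_def simp flip: sum_mset_sum_list)
    with that show "?V w = 0" by (intro subword_inv_eq_0 W) auto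
  qed
  have "sum W (words n M) = (\<Sum>r\<le>?K. ?B r * real (n choose r))" for n
  proof -
    have "sum W (words n M) = (\<Sum>w\<in>words n M. subword_sum ?V w)"
      by (simp add: subword_sum_inv)
    also have "\<dots> = (\<Sum>r\<le>n. real (n choose r) * ?B r)"
      by (rule sum_words_subword_sum[OF M])
    \<comment> \<open>A common range for both truncations: the binomials vanish for r > n, the
      values \<open>?B r\<close> for r > \<open>?K\<close>.\<close>
    also have "\<dots> = (\<Sum>r\<le>max n ?K. real (n choose r) * ?B r)"
      by (rule sum.mono_neutral_left) auto
    also have "\<dots> = (\<Sum>r\<le>?K. real (n choose r) * ?B r)"
      by (rule sum.mono_neutral_right) (auto simp: B)
    finally show ?thesis by (simp add: mult.commute)
  qed
  then show ?thesis using sum_poly[OF binomial_poly, where I = "{..?K}" and a = ?B] by auto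
qed

subsection \<open>Growth of diagrams\<close>

text \<open>Diagrams are handled as row-length functions on all of the naturals, so that opening a
  new row is a pointwise update like any other.\<close>

definition cells :: "(nat \<Rightarrow> nat) \<Rightarrow> (nat \<times> nat) set" where
  "cells f = {(i, j). j < f i}"

definition shapes :: "nat \<Rightarrow> (nat \<Rightarrow> nat) set" where
  "shapes n = {f. antimono f \<and> finite (cells f) \<and> card (cells f) = n}"

text \<open>A row has at most one addable and one removable box, so both are indexed by their row;
  the boxes are \<open>(i, f i)\<close> and \<open>(i, f i - 1)\<close>.\<close>

definition addable :: "(nat \<Rightarrow> nat) \<Rightarrow> nat set" where
  "addable f = {i. i = 0 \<or> f i < f (i - 1)}"

definition removable :: "(nat \<Rightarrow> nat) \<Rightarrow> nat set" where
  "removable f = {i. f (Suc i) < f i}"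

definition grow :: "(nat \<Rightarrow> nat) \<Rightarrow> nat \<Rightarrow> nat \<Rightarrow> nat" where
  "grow f i = f(i := Suc (f i))"

definition shrink :: "(nat \<Rightarrow> nat) \<Rightarrow> nat \<Rightarrow> nat \<Rightarrow> nat" where
  "shrink f i = f(i := f i - 1)"

definition ct :: "nat \<Rightarrow> nat \<Rightarrow> real" where
  "ct i j = real_of_int (content (i, j))"

lemma ct_eq: "ct i j = real j - real i"
  by (simp add: ct_def content_def)

lemma shapes_support:
  assumes "f \<in> shapes n"
  obtains N where "\<And>i. i \<ge> N \<Longrightarrow> f i = 0"
proof -
  have "{i. f i \<noteq> 0} = fst ` cells f"
    by (force simp: cells_def image_iff)
  then have "finite {i. f i \<noteq> 0}"
    using assms by (simp add: shapes_def)
  then obtain N where "\<forall>i\<in>{i. f i \<noteq> 0}. i < N"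
    by (auto simp: finite_nat_set_iff_bounded)
  then show ?thesis using that[of N] by fastforce
qed

lemma finite_removable: "f \<in> shapes n \<Longrightarrow> finite (removable f)"
proof -
  assume "f \<in> shapes n"
  then obtain N where "\<And>i. i \<ge> N \<Longrightarrow> f i = 0" by (rule shapes_support) blast
  then have "removable f \<subseteq> {..<N}"
    by (force simp: removable_def not_le[symmetric])
  then show ?thesis by (rule finite_subset) simp
qed

lemma finite_addable: "f \<in> shapes n \<Longrightarrow> finite (addable f)"
proof -
  assume f: "f \<in> shapes n"
  have "addable f \<subseteq> insert 0 (Suc ` removable f)"
  proof
    fix i assume "i \<in> addable f"
    then show "i \<in> insert 0 (Suc ` removable f)"
      by (cases i) (auto simp: addable_def removable_def)
  qed
  with finite_removable[OF f] show ?thesis by (meson finite_imageI finite_insert finite_subset)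
qed

lemma cells_grow: "cells (grow f i) = insert (i, f i) (cells f)"
  by (auto simp: cells_def grow_def split: if_splits)

lemma cells_shrink: "i \<in> removable f \<Longrightarrow> cells (shrink f i) = cells f - {(i, f i - 1)}"
  by (auto simp: cells_def removable_def shrink_def split: if_splits)

lemma corner_in_cells: "i \<in> removable f \<Longrightarrow> (i, f i - 1) \<in> cells f"
  by (auto simp: cells_def removable_def)

lemma grow_in_shapes: "f \<in> shapes n \<Longrightarrow> i \<in> addable f \<Longrightarrow> grow f i \<in> shapes (Suc n)"
proof -
  assume f: "f \<in> shapes n" and i: "i \<in> addable f"
  have "antimono (grow f i)"
    unfolding decseq_Suc_iff
  proof
    fix m
    have "f (Suc m) \<le> f m" using f by (simp add: shapes_def decseq_Suc_iff)
    then show "grow f i (Suc m) \<le> grow f i m" using i by (auto simp: addable_def grow_def)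
  qed
  moreover have "(i, f i) \<notin> cells f" by (simp add: cells_def)
  ultimately show ?thesis using f by (simp add: shapes_def cells_grow)
qed

lemma shrink_in_shapes: "f \<in> shapes (Suc n) \<Longrightarrow> i \<in> removable f \<Longrightarrow> shrink f i \<in> shapes n"
proof -
  assume f: "f \<in> shapes (Suc n)" and i: "i \<in> removable f"
  have "antimono (shrink f i)"
    unfolding decseq_Suc_iff
  proof
    fix m
    have "f (Suc m) \<le> f m" using f by (simp add: shapes_def decseq_Suc_iff)
    then show "shrink f i (Suc m) \<le> shrink f i m" using i by (auto simp: removable_def shrink_def)
  qed
  then show ?thesis using f corner_in_cells[OF i] by (simp add: shapes_def cells_shrink[OF i])
qed

lemma shapes_0: "shapes 0 = {\<lambda>_. 0}"
proof (intro equalityI subsetI)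
  fix f assume "f \<in> shapes 0"
  then have "cells f = {}" by (auto simp: shapes_def)
  then show "f \<in> {\<lambda>_. 0}" by (auto simp: cells_def fun_eq_iff)
qed (simp add: shapes_def cells_def antimono_def)

lemma removable_zero: "removable (\<lambda>_. 0) = {}"
  by (simp add: removable_def)

lemma shapes_shrinkE:
  assumes f: "f \<in> shapes n" "i \<in> removable f"
  obtains m where "n = Suc m" "shrink f i \<in> shapes m"
proof (cases n)
  case 0
  then show ?thesis using f by (simp add: shapes_0 removable_zero)
next
  case (Suc m)
  then show ?thesis using that shrink_in_shapes f by blast
qed

lemma shrink_addable: "f \<in> shapes n \<Longrightarrow> i \<in> removable f \<Longrightarrow> i \<in> addable (shrink f i)"
proof -
  assume f: "f \<in> shapes n" and i: "i \<in> removable f"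
  have "f i \<le> f (i - 1)" using f by (auto simp: shapes_def intro: decseqD)
  then show ?thesis using i by (auto simp: addable_def removable_def shrink_def)
qed

lemma grow_removable: "f \<in> shapes n \<Longrightarrow> i \<in> removable (grow f i)"
  by (auto simp: removable_def grow_def shapes_def decseq_Suc_iff less_Suc_eq_le)

lemma grow_shrink: "i \<in> removable f \<Longrightarrow> grow (shrink f i) i = f"
  by (auto simp: removable_def grow_def shrink_def fun_eq_iff)

lemma finite_shapes: "finite (shapes n)"
proof (induction n)
  case 0
  show ?case by (simp add: shapes_0)
next
  case (Suc n)
  have "shapes (Suc n) \<subseteq> (\<Union>g\<in>shapes n. grow g ` addable g)"
  proof
    fix f assume f: "f \<in> shapes (Suc n)"
    obtain N where N: "\<And>i. i \<ge> N \<Longrightarrow> f i = 0" using shapes_support[OF f] by blast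
    have "removable f \<noteq> {}"
    proof
      assume "removable f = {}"
      \<comment> \<open>Without a removable row the row lengths never decrease, yet they are
        eventually 0.\<close>
      then have "f 0 \<le> f i" for i
        by (induction i) (auto simp: removable_def not_less intro: order_trans)
      from this[of N] N have "f 0 = 0" by simp
      moreover have "f i \<le> f 0" for i using f by (simp add: shapes_def decseqD)
      ultimately have "cells f = {}" by (simp add: cells_def)
      with f show False by (simp add: shapes_def)
    qed
    then obtain i where i: "i \<in> removable f" by blast
    show "f \<in> (\<Union>g\<in>shapes n. grow g ` addable g)"
      by (rule UN_I[OF shrink_in_shapes[OF f i]], rule image_eqI[OF _ shrink_addable[OF f i]])
        (simp add: grow_shrink[OF i])
  qed
  moreover have "finite (\<Union>g\<in>shapes n. grow g ` addable g)"
    using Suc finite_addable by blast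
  ultimately show ?case by (rule finite_subset)
qed

section \<open>Functions of the corner contents\<close>

lemma sum_cells_shrink:
  assumes "f \<in> shapes n" "i \<in> removable f"
  shows "(\<Sum>(a, b)\<in>cells f. g a b) = g i (f i - 1) + (\<Sum>(a, b)\<in>cells (shrink f i). g a b :: real)"
proof -
  have "finite (cells f)" using assms(1) by (simp add: shapes_def)
  then show ?thesis
    by (simp add: sum.remove[OF _ corner_in_cells[OF assms(2)]] cells_shrink[OF assms(2)])
qed

text \<open>The contents of a row are consecutive integers, so the second differences collapse to
  first differences at the two ends.\<close>

lemma row_telescope:
  fixes g :: "real \<Rightarrow> real"
  shows "(\<Sum>j<m. g (ct i j + 1) + g (ct i j - 1) - 2 * g (ct i j))
    = g (real m - real i) - g (real m - 1 - real i) + g (- 1 - real i) - g (- real i)"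
  by (induction m) (simp_all add: ct_eq algebra_simps)

text \<open>Summing the row identities, the left ends telescope down the first column and the right
  ends leave one box just outside and one just inside each row. Where two consecutive rows have
  equal length these contributions cancel, so only corners remain.\<close>

lemma corner_sum:
  fixes g :: "real \<Rightarrow> real"
  assumes f: "f \<in> shapes n"
  shows "(\<Sum>i\<in>addable f. g (ct i (f i))) - (\<Sum>i\<in>removable f. g (ct i (f i - 1)))
    = g 0 + (\<Sum>(i, j)\<in>cells f. g (ct i j + 1) + g (ct i j - 1) - 2 * g (ct i j))"
proof -
  obtain N where N: "\<And>i. i \<ge> N \<Longrightarrow> f i = 0" using shapes_support[OF f] by blast
  have le: "f (Suc i) \<le> f i" for i using f by (simp add: shapes_def decseq_Suc_iff)
  have cells: "cells f = (SIGMA i:{..<N}. {..<f i})"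
    using N by (fastforce simp: cells_def not_le[symmetric])
  have "(\<Sum>(i, j)\<in>cells f. g (ct i j + 1) + g (ct i j - 1) - 2 * g (ct i j))
      = (\<Sum>i<N. \<Sum>j<f i. g (ct i j + 1) + g (ct i j - 1) - 2 * g (ct i j))"
    unfolding cells by (simp add: sum.Sigma)
  also have "\<dots> = (\<Sum>i<N. g (real (f i) - real i)) - (\<Sum>i<N. g (real (f i) - 1 - real i))
      + (\<Sum>i<N. g (- real (Suc i)) - g (- real i))"
    unfolding row_telescope by (simp add: sum.distrib sum_subtractf)
  \<comment> \<open>The value \<open>g (- real N)\<close> becomes the summand of the empty row
    \<open>N\<close>, which is why one sum below runs to \<open>N\<close> inclusive.\<close>
  also have "(\<Sum>i<N. g (- real (Suc i)) - g (- real i)) = g (- real N) - g 0"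
    by (subst sum_lessThan_telescope) simp
  finally have lhs: "g 0 + (\<Sum>(i, j)\<in>cells f. g (ct i j + 1) + g (ct i j - 1) - 2 * g (ct i j))
      = (\<Sum>i\<le>N. g (ct i (f i))) - (\<Sum>i<N. g (real (f i) - 1 - real i))"
    using N[of N] by (simp add: ct_eq lessThan_Suc_atMost[symmetric])
  have add: "addable f \<subseteq> {..N}"
  proof
    fix i assume "i \<in> addable f"
    then have "\<not> N \<le> i - 1 \<or> i = 0" using N[of "i - 1"] by (auto simp: addable_def)
    then show "i \<in> {..N}" by auto
  qed
  have rem: "removable f \<subseteq> {..<N}"
    using N by (force simp: removable_def not_le[symmetric])
  \<comment> \<open>Row \<open>Suc i\<close> fails to be addable exactly when row \<open>i\<close>
    fails to be removable. Then the two rows have equal length, and the box after row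
    \<open>Suc i\<close> has the same content as the last place of row \<open>i\<close>.\<close>
  have compl: "{..N} - addable f = Suc ` ({..<N} - removable f)"
  proof (intro equalityI subsetI)
    fix i assume "i \<in> {..N} - addable f"
    then show "i \<in> Suc ` ({..<N} - removable f)"
      by (cases i) (auto simp: addable_def removable_def)
  qed (auto simp: addable_def removable_def)
  have "(\<Sum>i\<in>{..N} - addable f. g (ct i (f i)))
      = (\<Sum>i\<in>{..<N} - removable f. g (real (f i) - 1 - real i))"
    unfolding compl
  proof (subst sum.reindex, simp, unfold o_def, rule sum.cong[OF refl])
    fix i assume "i \<in> {..<N} - removable f"
    with le[of i] have "f (Suc i) = f i" by (auto simp: removable_def)
    then show "g (ct (Suc i) (f (Suc i))) = g (real (f i) - 1 - real i)"
      by (simp add: ct_eq algebra_simps)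
  qed
  moreover have "(\<Sum>i\<in>removable f. g (ct i (f i - 1)))
      = (\<Sum>i\<in>removable f. g (real (f i) - 1 - real i))"
    by (rule sum.cong) (auto simp: removable_def ct_eq)
  ultimately show ?thesis
    unfolding lhs
    using sum.subset_diff[OF add, of "\<lambda>i. g (ct i (f i))"]
      sum.subset_diff[OF rem, of "\<lambda>i. g (real (f i) - 1 - real i)"]
    by simp
qed

lemma second_difference_power:
  fixes x :: real
  shows "(x + 1) ^ k + (x - 1) ^ k - 2 * x ^ k = (\<Sum>m<k - 1. diff_coeff k m * x ^ m)"
proof (cases k)
  case (Suc l)
  have "(x + 1) ^ k + (x - 1) ^ k = (\<Sum>m\<le>k. diff_coeff k m * x ^ m)"
    using binomial_ring[of x 1 k] binomial_ring[of x "- 1" k]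
    by (simp add: diff_coeff_def sum.distrib algebra_simps)
  also have "\<dots> = (\<Sum>m<k - 1. diff_coeff k m * x ^ m) + 2 * x ^ k"
    unfolding Suc by (simp add: lessThan_Suc_atMost[symmetric] diff_coeff_def)
  finally show ?thesis by simp
qed simp

definition power_sum :: "nat \<Rightarrow> (nat \<Rightarrow> nat) \<Rightarrow> real" where
  "power_sum m f = (\<Sum>(i, j)\<in>cells f. ct i j ^ m)"

lemma corner_power_sum:
  assumes f: "f \<in> shapes n"
  shows "(\<Sum>i\<in>addable f. ct i (f i) ^ k) - (\<Sum>i\<in>removable f. ct i (f i - 1) ^ k)
    = (if k = 0 then 1 else 0) + (\<Sum>m<k - 1. diff_coeff k m * power_sum m f)"
proof -
  have sums: "(\<Sum>(i, j)\<in>cells f. \<Sum>m<k - 1. diff_coeff k m * ct i j ^ m)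
      = (\<Sum>m<k - 1. diff_coeff k m * power_sum m f)"
    unfolding power_sum_def sum_distrib_left split_def by (rule sum.swap)
  then show ?thesis
    using corner_sum[OF f, of "\<lambda>x. x ^ k"]
    by (simp only: second_difference_power sums power_0_left)
qed

section \<open>Commuting box addition with box removal\<close>

text \<open>Adding in row \<open>a\<close> and removing in row \<open>b\<close> can be interchanged
  when \<open>a\<close> and \<open>b\<close> differ. The pairs with \<open>a = b\<close> return to
  \<open>f\<close> in both orders, and their difference is the diagonal commutator.\<close>

lemma up_down_commute:
  fixes \<phi> :: "nat \<Rightarrow> nat \<Rightarrow> real" and F :: "(nat \<Rightarrow> nat) \<Rightarrow> real"
  assumes f: "f \<in> shapes n"
  shows "(\<Sum>a\<in>addable f. \<Sum>b\<in>removable (grow f a).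
            \<phi> b (grow f a b - 1) * F (shrink (grow f a) b))
    = ((\<Sum>a\<in>addable f. \<phi> a (f a)) - (\<Sum>b\<in>removable f. \<phi> b (f b - 1))) * F f
      + (\<Sum>b\<in>removable f. \<phi> b (f b - 1) * (\<Sum>a\<in>addable (shrink f b). F (grow (shrink f b) a)))"
proof -
  let ?X = "\<lambda>a. removable (grow f a) - {a}" and ?Y = "\<lambda>b. addable (shrink f b) - {b}"
  let ?S = "SIGMA a:addable f. ?X a" and ?T = "SIGMA b:removable f. ?Y b"
  have fin: "finite (addable f)" "finite (removable f)"
    using f by (simp_all add: finite_addable finite_removable)
  have finX: "finite (removable (grow f a))" if "a \<in> addable f" for a
    using finite_removable grow_in_shapes[OF f that] by blast
  have finY: "finite (addable (shrink f b))" if "b \<in> removable f" for b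
    using shapes_shrinkE[OF f that] finite_addable by blast
  \<comment> \<open>Only adjacent rows could interfere. For \<open>a = Suc b\<close> both sides
    demand \<open>f a + 1 < f b\<close>; for \<open>b = Suc a\<close> neither operation affects the
    condition on the other.\<close>
  have mem: "(a, b) \<in> ?S \<longleftrightarrow> (b, a) \<in> ?T" for a b
  proof (cases "a = b \<or> a = Suc b \<or> b = Suc a")
    case True
    then show ?thesis
      by (elim disjE) (auto simp: addable_def removable_def grow_def shrink_def)
  next
    case False
    then have "a - 1 = b \<longleftrightarrow> a = 0 \<and> b = 0" by auto
    with False show ?thesis
      by (auto simp: addable_def removable_def grow_def shrink_def)
  qed
  have up: "(\<Sum>b\<in>removable (grow f a). \<phi> b (grow f a b - 1) * F (shrink (grow f a) b))
      = \<phi> a (f a) * F f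
        + (\<Sum>b\<in>?X a. \<phi> b (f b - 1) * F (f(a := Suc (f a), b := f b - 1)))"
    if "a \<in> addable f" for a
    by (subst sum.remove[OF finX[OF that] grow_removable[OF f]]) (simp add: grow_def shrink_def)
  have down: "(\<Sum>a\<in>addable (shrink f b). F (grow (shrink f b) a))
      = F f + (\<Sum>a\<in>?Y b. F (f(a := Suc (f a), b := f b - 1)))"
    if b: "b \<in> removable f" for b
  proof (subst sum.remove[OF finY[OF b] shrink_addable[OF f b]], rule arg_cong2[where f = plus])
    show "F (grow (shrink f b) b) = F f" using grow_shrink[OF b] by simp
    show "(\<Sum>a\<in>?Y b. F (grow (shrink f b) a)) = (\<Sum>a\<in>?Y b. F (f(a := Suc (f a), b := f b - 1)))"
      by (rule sum.cong) (auto simp: fun_upd_twist grow_def shrink_def)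
  qed
  have "(\<Sum>a\<in>addable f. \<Sum>b\<in>?X a. \<phi> b (f b - 1) * F (f(a := Suc (f a), b := f b - 1)))
      = (\<Sum>(a, b)\<in>?S. \<phi> b (f b - 1) * F (f(a := Suc (f a), b := f b - 1)))"
    using fin finX by (subst sum.Sigma) auto
  also have "\<dots> = (\<Sum>(b, a)\<in>?T. \<phi> b (f b - 1) * F (f(a := Suc (f a), b := f b - 1)))"
    by (rule sum.reindex_bij_witness[where i = "\<lambda>(b, a). (a, b)" and j = "\<lambda>(a, b). (b, a)"])
       (use mem in \<open>auto simp del: mem_Sigma_iff\<close>)
  also have "\<dots> = (\<Sum>b\<in>removable f. \<Sum>a\<in>?Y b. \<phi> b (f b - 1) * F (f(a := Suc (f a), b := f b - 1)))"
    using fin finY by (subst sum.Sigma) auto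
  finally have off: "(\<Sum>a\<in>addable f. \<Sum>b\<in>?X a. \<phi> b (f b - 1) * F (f(a := Suc (f a), b := f b - 1)))
      = (\<Sum>b\<in>removable f. \<Sum>a\<in>?Y b. \<phi> b (f b - 1) * F (f(a := Suc (f a), b := f b - 1)))" .
  have "(\<Sum>a\<in>addable f. \<Sum>b\<in>removable (grow f a).
            \<phi> b (grow f a b - 1) * F (shrink (grow f a) b))
      = (\<Sum>a\<in>addable f. \<phi> a (f a) * F f)
        + (\<Sum>a\<in>addable f. \<Sum>b\<in>?X a. \<phi> b (f b - 1) * F (f(a := Suc (f a), b := f b - 1)))"
    unfolding sum.distrib[symmetric] by (rule sum.cong[OF refl up])
  moreover have "(\<Sum>b\<in>removable f. \<phi> b (f b - 1) * (\<Sum>a\<in>addable (shrink f b). F (grow (shrink f b) a)))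
      = (\<Sum>b\<in>removable f. \<phi> b (f b - 1) * F f)
        + (\<Sum>b\<in>removable f. \<Sum>a\<in>?Y b. \<phi> b (f b - 1) * F (f(a := Suc (f a), b := f b - 1)))"
    unfolding sum.distrib[symmetric] sum_distrib_left[symmetric] distrib_left[symmetric]
    by (rule sum.cong[OF refl]) (simp only: down)
  ultimately show ?thesis
    by (simp only: off left_diff_distrib sum_distrib_right)
qed

primrec wt :: "nat list \<Rightarrow> (nat \<Rightarrow> nat) \<Rightarrow> real" where
  "wt [] f = (if f = (\<lambda>_. 0) then 1 else 0)"
| "wt (k # w) f = (\<Sum>i\<in>removable f. ct i (f i - 1) ^ k * wt w (shrink f i))"

text \<open>In each chain from the empty diagram to \<open>f\<close> every box belongs to exactly
  one letter. Raising the letters in turn therefore multiplies the weight by the power sum of all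
  contents, the same for every chain.\<close>

lemma raise_wt: "f \<in> shapes n \<Longrightarrow> raise m (\<lambda>u. wt u f) w = power_sum m f * wt w f"
proof (induction w arbitrary: f n)
  case Nil
  then show ?case by (simp add: power_sum_def cells_def)
next
  case (Cons k w)
  have "raise m (\<lambda>u. wt u (shrink f i)) w + ct i (f i - 1) ^ m * wt w (shrink f i)
      = power_sum m f * wt w (shrink f i)" if i: "i \<in> removable f" for i
  proof -
    obtain l where "shrink f i \<in> shapes l" using shapes_shrinkE[OF Cons.prems i] by blast
    from Cons.IH[OF this] show ?thesis
      using sum_cells_shrink[OF Cons.prems i, of "\<lambda>a b. ct a b ^ m"]
      by (simp only: power_sum_def distrib_right add.commute)
  qed
  then have "(\<Sum>i\<in>removable f. ct i (f i - 1) ^ k *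
        (raise m (\<lambda>u. wt u (shrink f i)) w + ct i (f i - 1) ^ m * wt w (shrink f i)))
      = power_sum m f * wt (k # w) f"
    by (simp add: sum_distrib_left mult.left_commute)
  then show ?case
    by (simp add: raise_sum sum.distrib distrib_left power_add mult.assoc)
qed

lemma sum_wt_grow: "f \<in> shapes n \<Longrightarrow> (\<Sum>a\<in>addable f. wt w (grow f a)) = lower (\<lambda>u. wt u f) w"
proof (induction w arbitrary: f n)
  case Nil
  \<comment> \<open>D annihilates the empty diagram, which matches the value 0 of
    \<open>lower\<close> at the empty word.\<close>
  have "grow f a \<noteq> (\<lambda>_. 0)" for a by (auto simp: fun_eq_iff grow_def)
  then show ?case by (simp only: wt.simps lower.simps if_False sum.neutral_const)
next
  case (Cons k w)
  note f = Cons.prems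
  have IH: "(\<Sum>a\<in>addable (shrink f b). wt w (grow (shrink f b) a)) = lower (\<lambda>u. wt u (shrink f b)) w"
    if b: "b \<in> removable f" for b
    using shapes_shrinkE[OF f b] Cons.IH by blast
  have "(\<Sum>a\<in>addable f. wt (k # w) (grow f a))
      = ((if k = 0 then 1 else 0) + (\<Sum>m<k - 1. diff_coeff k m * power_sum m f)) * wt w f
        + (\<Sum>b\<in>removable f. ct b (f b - 1) ^ k * lower (\<lambda>u. wt u (shrink f b)) w)"
    unfolding wt.simps up_down_commute[OF f, of "\<lambda>i j. ct i j ^ k" "wt w"] corner_power_sum[OF f]
    by (simp add: IH)
  then show ?case
    by (simp add: lower_sum raise_wt[OF f] distrib_right sum_distrib_right mult.assoc)
qed

subsection \<open>Tableaux and Plancherel averages\<close>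

definition tableaux :: "(nat \<Rightarrow> nat) \<Rightarrow> (nat \<times> nat \<Rightarrow> nat) set" where
  "tableaux f = {T. bij_betw T (cells f) {1..card (cells f)}
               \<and> (\<forall>b. b \<notin> cells f \<longrightarrow> T b = 0)
               \<and> (\<forall>i j. (i, Suc j) \<in> cells f \<longrightarrow> T (i, j) < T (i, Suc j))
               \<and> (\<forall>i j. (Suc i, j) \<in> cells f \<longrightarrow> T (i, j) < T (Suc i, j))}"

definition num_tableaux :: "(nat \<Rightarrow> nat) \<Rightarrow> real" where
  "num_tableaux f = real (card (tableaux f))"

lemma tableaux_zero: "tableaux (\<lambda>_. 0) = {\<lambda>_. 0}"
  by (auto simp: tableaux_def cells_def fun_eq_iff bij_betw_def)

lemma tableaux_le:
  assumes f: "f \<in> shapes n" and T: "T \<in> tableaux f"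
  shows "T x \<le> n"
proof (cases "x \<in> cells f")
  case True
  have "bij_betw T (cells f) {1..n}" using f T by (simp add: tableaux_def shapes_def)
  from bij_betwE[OF this] True show ?thesis by auto
next
  case False
  then have "T x = 0" using T unfolding tableaux_def by blast
  then show ?thesis by simp
qed

text \<open>No entry can exceed the largest one, so its box has no neighbour to the right or below
  and is a corner.\<close>

lemma tableaux_maximum:
  assumes f: "f \<in> shapes (Suc n)" and T: "T \<in> tableaux f"
  obtains b where "b \<in> removable f" "T (b, f b - 1) = Suc n"
    "T((b, f b - 1) := 0) \<in> tableaux (shrink f b)"
proof -
  have card: "card (cells f) = Suc n" using f by (simp add: shapes_def)
  have bij: "bij_betw T (cells f) {1..Suc n}" using T card by (simp add: tableaux_def)
  then have "Suc n \<in> T ` cells f" by (simp add: bij_betw_def)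
  then obtain i j where ij: "(i, j) \<in> cells f" "T (i, j) = Suc n" by auto
  have bound: "T x \<le> Suc n" if "x \<in> cells f" for x
    using bij_betwE[OF bij] that by auto
  have right: "(i, Suc j) \<notin> cells f"
    using bound[of "(i, Suc j)"] ij T by (fastforce simp: tableaux_def)
  with ij have j: "j = f i - 1" "j < f i" by (auto simp: cells_def)
  have below: "(Suc i, j) \<notin> cells f"
    using bound[of "(Suc i, j)"] ij T by (fastforce simp: tableaux_def)
  with j have i: "i \<in> removable f" by (auto simp: cells_def removable_def)
  have cells: "cells (shrink f i) = cells f - {(i, j)}" using cells_shrink[OF i] j by simp
  have "bij_betw T (cells f - {(i, j)}) ({1..Suc n} - {Suc n})"
    using bij_betw_DiffI[OF bij, of "{(i, j)}" "{Suc n}"] ij by (simp add: bij_betw_def)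
  also have "{1..Suc n} - {Suc n} = {1..n}" by auto
  finally have "bij_betw (T((i, j) := 0)) (cells f - {(i, j)}) {1..n}"
    by (rule bij_betw_cong[THEN iffD1, rotated]) auto
  moreover have "card (cells f - {(i, j)}) = n" using card ij(1) by simp
  \<comment> \<open>The cleared corner is neither left of nor above a remaining box, so no
    inequality of the smaller tableau involves it.\<close>
  moreover have "(i, j) \<noteq> (i', j')" if "(i', Suc j') \<in> cells (shrink f i) \<or> (Suc i', j') \<in> cells (shrink f i)"
    for i' j'
    using that i j by (auto simp: cells_def shrink_def removable_def split: if_splits)
  ultimately have "T((i, j) := 0) \<in> tableaux (shrink f i)"
    using T right below by (auto simp: tableaux_def cells)
  with i ij j show ?thesis using that by blast
qed

lemma tableaux_extend:
  assumes f: "f \<in> shapes (Suc n)" and b: "b \<in> removable f" and T: "T \<in> tableaux (shrink f b)"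
  shows "T((b, f b - 1) := Suc n) \<in> tableaux f"
proof -
  let ?c = "(b, f b - 1)"
  have card: "card (cells f) = Suc n" using f by (simp add: shapes_def)
  have c: "?c \<in> cells f" by (rule corner_in_cells[OF b])
  have cells: "cells (shrink f b) = cells f - {?c}" by (rule cells_shrink[OF b])
  have cells_f: "cells f = insert ?c (cells (shrink f b))" using c cells by blast
  have card': "card (cells (shrink f b)) = n"
    using shrink_in_shapes[OF f b] by (simp add: shapes_def)
  have bij: "bij_betw T (cells (shrink f b)) {1..n}" using T card' by (simp add: tableaux_def)
  note le = tableaux_le[OF shrink_in_shapes[OF f b] T]
  have "bij_betw (T(?c := Suc n)) (cells (shrink f b)) {1..n}"
    using bij by (rule bij_betw_cong[THEN iffD1, rotated]) (auto simp: cells)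
  moreover have "bij_betw (T(?c := Suc n)) {?c} {Suc n}" by simp
  ultimately have "bij_betw (T(?c := Suc n)) (cells (shrink f b) \<union> {?c}) ({1..n} \<union> {Suc n})"
    by (rule bij_betw_combine) auto
  also have "cells (shrink f b) \<union> {?c} = cells f" using cells_f by blast
  also have "{1..n} \<union> {Suc n} = {1..Suc n}" by auto
  finally have "bij_betw (T(?c := Suc n)) (cells f) {1..card (cells f)}" unfolding card .
  moreover have "?c \<noteq> (i, j)" if "(i, Suc j) \<in> cells f \<or> (Suc i, j) \<in> cells f" for i j
    using that b by (auto simp: cells_def removable_def)
  moreover have "T x < Suc n" for x using le by (simp add: less_Suc_eq_le)
  ultimately show ?thesis
    using T by (auto simp: tableaux_def cells_f)
qed

lemma finite_tableaux: "f \<in> shapes n \<Longrightarrow> finite (tableaux f)"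
proof -
  assume f: "f \<in> shapes n"
  have "tableaux f \<subseteq> {T. \<forall>x. (x \<in> cells f \<longrightarrow> T x \<in> {..n}) \<and> (x \<notin> cells f \<longrightarrow> T x = 0)}"
  proof
    fix T assume T: "T \<in> tableaux f"
    then have "\<forall>x. x \<notin> cells f \<longrightarrow> T x = 0" unfolding tableaux_def by blast
    with tableaux_le[OF f T]
    show "T \<in> {T. \<forall>x. (x \<in> cells f \<longrightarrow> T x \<in> {..n}) \<and> (x \<notin> cells f \<longrightarrow> T x = 0)}" by simp
  qed
  moreover have "finite \<dots>"
    by (rule finite_set_of_finite_funs) (use f in \<open>simp_all add: shapes_def\<close>)
  ultimately show ?thesis by (rule finite_subset)
qed

text \<open>Sorting tableaux by the corner that holds the largest entry; the pieces are disjoint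
  because all other entries are at most \<open>n\<close>.\<close>

lemma num_tableaux_branching:
  assumes f: "f \<in> shapes (Suc n)"
  shows "num_tableaux f = (\<Sum>b\<in>removable f. num_tableaux (shrink f b))"
proof -
  let ?E = "\<lambda>b T. T((b, f b - 1) := Suc n) :: nat \<times> nat \<Rightarrow> nat"
  have shr: "shrink f b \<in> shapes n" if "b \<in> removable f" for b
    by (rule shrink_in_shapes[OF f that])
  have lt: "T x \<noteq> Suc n" if "b \<in> removable f" "T \<in> tableaux (shrink f b)" for b T x
    using tableaux_le[OF shr[OF that(1)] that(2), of x] by simp
  have corner: "T (b, f b - 1) = 0" if "b \<in> removable f" "T \<in> tableaux (shrink f b)" for b T
    using that by (simp add: tableaux_def cells_shrink)
  have "tableaux f = (\<Union>b\<in>removable f. ?E b ` tableaux (shrink f b))"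
  proof (intro equalityI subsetI)
    fix T assume T: "T \<in> tableaux f"
    obtain b where b: "b \<in> removable f" "T (b, f b - 1) = Suc n"
      "T((b, f b - 1) := 0) \<in> tableaux (shrink f b)"
      using tableaux_maximum[OF f T] .
    then have "T = ?E b (T((b, f b - 1) := 0))" by (auto simp: fun_eq_iff)
    with b show "T \<in> (\<Union>b\<in>removable f. ?E b ` tableaux (shrink f b))" by blast
  qed (use tableaux_extend[OF f] in auto)
  moreover have "card (\<Union>b\<in>removable f. ?E b ` tableaux (shrink f b))
      = (\<Sum>b\<in>removable f. card (?E b ` tableaux (shrink f b)))"
  proof (rule card_UN_disjoint)
    show "\<forall>b\<in>removable f. \<forall>b'\<in>removable f. b \<noteq> b' \<longrightarrow>
        ?E b ` tableaux (shrink f b) \<inter> ?E b' ` tableaux (shrink f b') = {}"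
    proof (intro ballI impI equals0I)
      fix b b' T
      assume b: "b \<in> removable f" "b' \<in> removable f" "b \<noteq> b'"
        and "T \<in> ?E b ` tableaux (shrink f b) \<inter> ?E b' ` tableaux (shrink f b')"
      then obtain T1 T2 where T: "T1 \<in> tableaux (shrink f b)" "T2 \<in> tableaux (shrink f b')"
        "?E b T1 = ?E b' T2" by auto
      have "T2 (b, f b - 1) = Suc n"
        using fun_cong[OF T(3), of "(b, f b - 1)"] b by simp
      then show False using lt[OF b(2) T(2)] by blast
    qed
  qed (use f shr finite_removable finite_tableaux in blast)+
  moreover have "card (?E b ` tableaux (shrink f b)) = card (tableaux (shrink f b))"
    if b: "b \<in> removable f" for b
  proof (rule card_image, rule inj_onI)
    fix T1 T2 assume T: "T1 \<in> tableaux (shrink f b)" "T2 \<in> tableaux (shrink f b)" "?E b T1 = ?E b T2"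
    show "T1 = T2"
    proof
      fix x
      show "T1 x = T2 x"
        using fun_cong[OF T(3), of x] corner[OF b T(1)] corner[OF b T(2)]
        by (cases "x = (b, f b - 1)") auto
    qed
  qed
  ultimately show ?thesis by (simp add: num_tableaux_def)
qed

text \<open>Branching expresses the tableau count through smaller diagrams; regrouping the edges of
  the Young graph by their lower end moves the removal of a box from \<open>num_tableaux\<close>
  onto \<open>v\<close>.\<close>

lemma sum_num_tableaux:
  "(\<Sum>f\<in>shapes (Suc n). num_tableaux f * v f)
   = (\<Sum>g\<in>shapes n. num_tableaux g * (\<Sum>a\<in>addable g. v (grow g a)))"
proof -
  have "(\<Sum>f\<in>shapes (Suc n). num_tableaux f * v f)
      = (\<Sum>f\<in>shapes (Suc n). \<Sum>b\<in>removable f. num_tableaux (shrink f b) * v f)"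
    by (simp add: num_tableaux_branching sum_distrib_right)
  also have "\<dots> = (\<Sum>(f, b)\<in>(SIGMA f:shapes (Suc n). removable f). num_tableaux (shrink f b) * v f)"
    by (rule sum.Sigma) (use finite_shapes finite_removable in auto)
  also have "\<dots> = (\<Sum>(g, a)\<in>(SIGMA g:shapes n. addable g). num_tableaux g * v (grow g a))"
    by (rule sum.reindex_bij_witness[where i = "\<lambda>(g, a). (grow g a, a)" and j = "\<lambda>(f, b). (shrink f b, b)"])
       (auto simp: grow_shrink shrink_in_shapes shrink_addable grow_in_shapes grow_removable,
        auto simp: grow_def shrink_def fun_eq_iff)
  also have "\<dots> = (\<Sum>g\<in>shapes n. \<Sum>a\<in>addable g. num_tableaux g * v (grow g a))"
    by (rule sum.Sigma[symmetric]) (use finite_shapes finite_addable in auto)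
  finally show ?thesis by (simp add: sum_distrib_left)
qed

section \<open>Averages of words\<close>

text \<open>This is W(w): \<open>num_tableaux f\<close> is the result of applying D to
  \<open>f\<close> until the empty diagram is reached.\<close>

definition word_avg :: "nat list \<Rightarrow> real" where
  "word_avg w = (\<Sum>f\<in>shapes (length w). num_tableaux f * wt w f) / fact (length w)"

text \<open>One of the n + 1 operators D is applied to the word by \<open>sum_wt_grow\<close>, and
  the factor |w| turns (n + 1)! into n!.\<close>

lemma word_avg_lower: "real (length w) * word_avg w = lower word_avg w"
proof (cases w)
  case (Cons k u)
  define n where "n = length u"
  have n: "length w = Suc n" using Cons n_def by simp
  have "real (length w) * word_avg w = (\<Sum>f\<in>shapes (Suc n). num_tableaux f * wt w f) / fact n"
    unfolding word_avg_def n fact_Suc by (simp del: of_nat_Suc)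
  also have "\<dots> = (\<Sum>g\<in>shapes n. num_tableaux g * lower (\<lambda>u. wt u g) w) / fact n"
    by (simp add: sum_num_tableaux sum_wt_grow)
  also have "\<dots> = lower (\<lambda>u. \<Sum>g\<in>shapes n. (num_tableaux g / fact n) * wt u g) w"
    unfolding lower_sum by (simp add: sum_divide_distrib)
  \<comment> \<open>\<open>lower\<close> evaluates its argument only at words of length
    \<open>n\<close>, where the normalisation is the same \<open>fact n\<close>.\<close>
  also have "\<dots> = lower word_avg w"
    by (rule lower_cong) (simp add: n word_avg_def sum_divide_distrib)
  finally show ?thesis .
qed simp

section \<open>Monomial symmetric functions of the contents\<close>

text \<open>Indexing by a multiset instead of a partition allows a single part to be removed as
  \<open>M - {#k#}\<close>.\<close>

definition monomial_sum :: "nat multiset \<Rightarrow> real list \<Rightarrow> real" where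
  "monomial_sum M xs = (\<Sum>al\<in>words (length xs) M. \<Prod>i<length xs. (xs ! i) ^ (al ! i))"

lemma mono_sym_eq: "mono_sym mu xs = monomial_sum (mset mu) xs"
  by (simp add: mono_sym_def monomial_sum_def words_def)

lemma monomial_sum_Cons:
  assumes "0 \<notin># M"
  shows "monomial_sum M (x # xs)
    = (\<Sum>k\<in>insert 0 (set_mset M). x ^ k * monomial_sum (M - {#k#}) xs)"
  unfolding monomial_sum_def length_Cons sum_words_Suc[OF assms]
  by (simp add: prod.lessThan_Suc_shift sum_distrib_left del: sum.insert prod.lessThan_Suc)

text \<open>A permutation of the variables is compensated by the same permutation of the exponents,
  under which \<open>words n M\<close> is stable.\<close>

lemma monomial_sum_perm:
  assumes "mset xs = mset ys"
  shows "monomial_sum M xs = monomial_sum M ys"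
proof -
  obtain p where p: "p permutes {..<length ys}" "permute_list p ys = xs"
    using mset_eq_permutation[OF assms] .
  let ?n = "length ys" and ?q = "inv p"
  have q: "?q permutes {..<?n}" by (rule permutes_inv[OF p(1)])
  have len: "length xs = ?n" using assms by (rule mset_eq_length)
  have mset_filter: "mset (filter P (permute_list r al)) = mset (filter P al)"
    if "r permutes {..<?n}" "length al = ?n" for r P and al :: "nat list"
    using that by (simp add: mset_filter)
  have words: "permute_list r al \<in> words ?n M" if "r permutes {..<?n}" "al \<in> words ?n M" for r al
    using that mset_filter[of r al] by (simp add: words_def)
  have inv: "permute_list r (permute_list s al) = al"
    if "r permutes {..<?n}" "s \<circ> r = id" "al \<in> words ?n M" for r s al
    using that permute_list_compose[of r al s] by (simp add: words_def)
  have "(\<Sum>al\<in>words ?n M. \<Prod>i<?n. (ys ! i) ^ (al ! i))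
      = (\<Sum>al\<in>words ?n M. \<Prod>i<?n. (xs ! i) ^ (al ! i))"
  proof (rule sum.reindex_bij_witness[where i = "permute_list ?q" and j = "permute_list p"])
    fix al assume al: "al \<in> words ?n M"
    show "permute_list ?q (permute_list p al) = al"
      using inv[OF q _ al] permutes_inv_o[OF p(1)] by simp
    show "permute_list p (permute_list ?q al) = al"
      using inv[OF p(1) _ al] permutes_inv_o[OF p(1)] by simp
    have "(\<Prod>i<?n. (xs ! i) ^ (permute_list p al ! i)) = (\<Prod>i<?n. (ys ! p i) ^ (al ! p i))"
      using al p by (intro prod.cong refl) (auto simp: words_def permute_list_nth)
    also have "\<dots> = (\<Prod>i<?n. (ys ! i) ^ (al ! i))"
      using prod.permute[OF p(1), of "\<lambda>i. (ys ! i) ^ (al ! i)"] by (simp add: o_def)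
    finally show "(\<Prod>i<?n. (xs ! i) ^ (permute_list p al ! i)) = (\<Prod>i<?n. (ys ! i) ^ (al ! i))" .
  qed (use words p q in auto)
  then show ?thesis by (simp add: monomial_sum_def len)
qed

text \<open>Each tableau lists the contents in some order, and summing its weight over all words
  gives the monomial function in that order, hence the same value for all tableaux. In the induction
  symmetry puts the content of the removed corner first, and its exponent is the first
  letter.\<close>

lemma sum_words_wt:
  assumes "f \<in> shapes n" "0 \<notin># M" "mset xs = image_mset (\<lambda>(i, j). ct i j) (mset_set (cells f))"
  shows "(\<Sum>w\<in>words n M. wt w f) = num_tableaux f * monomial_sum M xs"
  using assms
proof (induction n arbitrary: f M xs)
  case 0
  then have "f = (\<lambda>_. 0)" "xs = []" by (auto simp: shapes_0 cells_def)
  then show ?case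
    by (simp add: words_0 monomial_sum_def num_tableaux_def tableaux_zero)
next
  case (Suc n)
  note f = Suc.prems(1) and M = Suc.prems(2)
  let ?I = "insert 0 (set_mset M)"
  let ?c = "\<lambda>b. ct b (f b - 1)"
  have fin: "finite (cells f)" using f by (simp add: shapes_def)
  have M': "0 \<notin># M - {#k#}" for k using M by (meson in_diffD)
  have step: "(\<Sum>k\<in>?I. ?c b ^ k * (\<Sum>w\<in>words n (M - {#k#}). wt w (shrink f b)))
      = num_tableaux (shrink f b) * monomial_sum M xs" if b: "b \<in> removable f" for b
  proof -
    obtain ys where ys: "mset ys = image_mset (\<lambda>(i, j). ct i j) (mset_set (cells (shrink f b)))"
      using ex_mset by blast
    have "mset_set (cells f) = add_mset (b, f b - 1) (mset_set (cells (shrink f b)))"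
      unfolding cells_shrink[OF b] using mset_set.remove[OF fin corner_in_cells[OF b]] .
    then have "mset xs = mset (?c b # ys)" using Suc.prems(3) ys by simp
    then have "monomial_sum M xs = monomial_sum M (?c b # ys)" by (rule monomial_sum_perm)
    then show ?thesis
      using Suc.IH[OF shrink_in_shapes[OF f b] M' ys]
      by (simp add: monomial_sum_Cons[OF M] sum_distrib_left mult.left_commute del: sum.insert)
  qed
  have "(\<Sum>w\<in>words (Suc n) M. wt w f)
      = (\<Sum>k\<in>?I. \<Sum>w\<in>words n (M - {#k#}). \<Sum>b\<in>removable f. ?c b ^ k * wt w (shrink f b))"
    by (simp add: sum_words_Suc[OF M] del: sum.insert)
  also have "\<dots> = (\<Sum>k\<in>?I. \<Sum>b\<in>removable f. ?c b ^ k * (\<Sum>w\<in>words n (M - {#k#}). wt w (shrink f b)))"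
    unfolding sum_distrib_left by (intro sum.cong refl sum.swap)
  also have "\<dots> = (\<Sum>b\<in>removable f. \<Sum>k\<in>?I. ?c b ^ k * (\<Sum>w\<in>words n (M - {#k#}). wt w (shrink f b)))"
    by (rule sum.swap)
  also have "\<dots> = (\<Sum>b\<in>removable f. num_tableaux (shrink f b) * monomial_sum M xs)"
    by (rule sum.cong[OF refl step])
  also have "\<dots> = num_tableaux f * monomial_sum M xs"
    by (simp add: num_tableaux_branching[OF f] sum_distrib_right)
  finally show ?case .
qed

section \<open>Partitions as row-length functions\<close>

definition row_fun :: "nat list \<Rightarrow> nat \<Rightarrow> nat" where
  "row_fun la i = (if i < length la then la ! i else 0)"

lemma boxes_eq_cells: "boxes la = cells (row_fun la)"
  by (auto simp: boxes_def cells_def row_fun_def split: if_splits)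

lemma mset_concat_rows:
  "mset (concat (map (\<lambda>i. map (h i) [0..<f i]) [0..<N]))
   = image_mset (\<lambda>(i, j). h i j) (mset_set (SIGMA i:{..<N}. {..<f i}))"
proof (induction N)
  case (Suc N)
  have "(SIGMA i:{..<Suc N}. {..<f i}) = (SIGMA i:{..<N}. {..<f i}) \<union> Pair N ` {..<f N}"
    by (auto simp: less_Suc_eq)
  moreover have "mset_set ((SIGMA i:{..<N}. {..<f i}) \<union> Pair N ` {..<f N})
      = mset_set (SIGMA i:{..<N}. {..<f i}) + mset_set (Pair N ` {..<f N})"
    by (rule mset_set_Union) auto
  moreover have "mset_set (Pair N ` {..<f N}) = image_mset (Pair N) (mset_set {..<f N})"
    by (rule image_mset_mset_set[symmetric]) (simp add: inj_on_def)
  moreover have "mset (map (h N) [0..<f N]) = image_mset (h N) (mset_set {..<f N})"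
    by (simp flip: atLeast0LessThan)
  ultimately show ?case
    using Suc by (simp add: multiset.map_comp o_def)
qed simp

lemma cells_row_fun: "cells (row_fun la) = (SIGMA i:{..<length la}. {..<la ! i})"
  by (auto simp: cells_def row_fun_def split: if_splits)

lemma mset_contents:
  "mset (contents la) = image_mset (\<lambda>(i, j). ct i j) (mset_set (cells (row_fun la)))"
  unfolding contents_def cells_row_fun ct_def[symmetric] by (rule mset_concat_rows)

lemma card_cells_row_fun: "card (cells (row_fun la)) = sum_list la"
  by (simp add: cells_row_fun sum_list_sum_nth atLeast0LessThan)

lemma dimYD_eq: "real (dimYD la) = num_tableaux (row_fun la)"
  by (simp add: dimYD_def num_tableaux_def SYT_def tableaux_def boxes_eq_cells card_cells_row_fun)

lemma row_fun_pos: "is_partition la \<Longrightarrow> row_fun la i > 0 \<longleftrightarrow> i < length la"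
  by (auto simp: is_partition_def row_fun_def in_set_conv_nth)

lemma bij_betw_row_fun: "bij_betw row_fun (YD n) (shapes n)"
  unfolding bij_betw_def
proof (intro conjI inj_onI equalityI subsetI)
  fix la mu assume la: "la \<in> YD n" "mu \<in> YD n" and eq: "row_fun la = row_fun mu"
  then have "i < length la \<longleftrightarrow> i < length mu" for i
    using row_fun_pos[of la i] row_fun_pos[of mu i] by (simp add: YD_def)
  then have "length la = length mu" by (meson linorder_neqE_nat less_irrefl)
  then show "la = mu"
  proof (rule nth_equalityI)
    fix i assume "i < length la"
    then show "la ! i = mu ! i"
      using fun_cong[OF eq, of i] \<open>length la = length mu\<close> by (simp add: row_fun_def)
  qed
next
  fix f assume "f \<in> row_fun ` YD n"
  then obtain la where la: "la \<in> YD n" "f = row_fun la" by blast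
  have "antimono (row_fun la)"
  proof (rule antimonoI)
    fix i j :: nat assume "i \<le> j"
    then show "row_fun la j \<le> row_fun la i"
      using la by (auto simp: row_fun_def YD_def is_partition_def sorted_rev_iff_nth_mono)
  qed
  moreover have "finite (cells (row_fun la))" by (simp add: cells_row_fun)
  ultimately show "f \<in> shapes n"
    using la by (simp add: shapes_def card_cells_row_fun YD_def)
next
  fix f assume f: "f \<in> shapes n"
  then have anti: "antimono f" by (simp add: shapes_def)
  obtain K where K: "\<And>i. i \<ge> K \<Longrightarrow> f i = 0" using shapes_support[OF f] by blast
  \<comment> \<open>The number of parts is the first index where \<open>f\<close> vanishes;
    monotonicity keeps \<open>f\<close> at 0 from there on.\<close>
  define N where "N = (LEAST i. f i = 0)"
  have "f N = 0" unfolding N_def by (rule LeastI[of _ K]) (simp add: K)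
  then have N: "f i = 0 \<longleftrightarrow> N \<le> i" for i
    using decseqD[OF anti, of N i] by (auto simp: N_def intro: Least_le)
  let ?la = "map f [0..<N]"
  have row: "row_fun ?la = f" by (auto simp: row_fun_def fun_eq_iff N)
  have "is_partition ?la"
    using anti N by (auto simp: is_partition_def sorted_rev_iff_nth_mono decseqD not_le)
  moreover have "sum_list ?la = n"
    using card_cells_row_fun[of ?la] f by (simp add: row shapes_def)
  ultimately show "f \<in> row_fun ` YD n" using row by (force simp: YD_def)
qed

text \<open>One of the two dimension factors turns the monomial function into a sum over words by
  \<open>sum_words_wt\<close>; the other is the weight in \<open>word_avg\<close>.\<close>

lemma plancherel_avg_mono_sym:
  assumes "is_partition mu"
  shows "plancherel_avg (\<lambda>la. mono_sym mu (contents la)) n = sum word_avg (words n (mset mu))"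
proof -
  let ?M = "mset mu"
  have M: "0 \<notin># ?M" using assms by (simp add: is_partition_def)
  have "plancherel_avg (\<lambda>la. mono_sym mu (contents la)) n
      = (\<Sum>la\<in>YD n. num_tableaux (row_fun la) * (\<Sum>w\<in>words n ?M. wt w (row_fun la)) / fact n)"
    unfolding plancherel_avg_def
  proof (rule sum.cong[OF refl])
    fix la assume "la \<in> YD n"
    then have "row_fun la \<in> shapes n" using bij_betw_row_fun by (rule bij_betwE[rule_format, rotated])
    from sum_words_wt[OF this M mset_contents]
    show "real (dimYD la) ^ 2 / fact n * mono_sym mu (contents la)
        = num_tableaux (row_fun la) * (\<Sum>w\<in>words n ?M. wt w (row_fun la)) / fact n"
      by (simp add: dimYD_eq mono_sym_eq power2_eq_square)
  qed
  also have "\<dots> = (\<Sum>f\<in>shapes n. num_tableaux f * (\<Sum>w\<in>words n ?M. wt w f) / fact n)"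
    by (rule sum.reindex_bij_betw[OF bij_betw_row_fun])
  also have "\<dots> = (\<Sum>w\<in>words n ?M. (\<Sum>f\<in>shapes n. num_tableaux f * wt w f) / fact n)"
    unfolding sum_distrib_left sum_divide_distrib by (rule sum.swap)
  also have "\<dots> = sum word_avg (words n ?M)"
    by (rule sum.cong) (auto simp: word_avg_def words_def)
  finally show ?thesis .
qed

theorem theorem1:
  fixes c :: "nat list \<Rightarrow> real"
  assumes "is_symfun c"
  shows "\<exists>P :: real poly. \<forall>n\<ge>1. plancherel_avg (G c) n = poly P (real n)"
proof -
  \<comment> \<open>The average is linear in the coefficients, which reduces the claim to single
    monomial functions.\<close>
  have "plancherel_avg (G c) n
      = (\<Sum>mu\<in>{mu. c mu \<noteq> 0}. c mu * plancherel_avg (\<lambda>la. mono_sym mu (contents la)) n)" for n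
    unfolding plancherel_avg_def G_def symfun_eval_def sum_distrib_left
    by (subst sum.swap) (simp add: mult.left_commute)
  moreover have "\<exists>P :: real poly. \<forall>n. plancherel_avg (\<lambda>la. mono_sym mu (contents la)) n = poly P (real n)"
    if "mu \<in> {mu. c mu \<noteq> 0}" for mu
  proof -
    have mu: "is_partition mu" using that assms by (simp add: is_symfun_def)
    then have "0 \<notin># mset mu" by (simp add: is_partition_def)
    from sum_words_poly[OF this word_avg_lower] show ?thesis
      by (simp add: plancherel_avg_mono_sym[OF mu])
  qed
  ultimately show ?thesis
    using sum_poly[where I = "{mu. c mu \<noteq> 0}" and a = c
        and F = "\<lambda>mu. plancherel_avg (\<lambda>la. mono_sym mu (contents la))"]
    by (simp, blast)
qed

end
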